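(* Let $F_{\log}\colon\mathbb{R}^2\to\left]-\infty,+\infty\right]$ be the Fitzpatrick function of the natural logarithm (an operator on $\mathbb{R}$ with domain $\left]0,\infty\right[$). Its Fenchel conjugate $F_{\log}^\ast\colon\mathbb{R}^2\to\left]-\infty,+\infty\right]$ is given by $$F_{\log}^\ast(x,y)=\begin{cases} y\log(y) & \text{if } y>0\text{ and } x\leq\log(y),\\ \infty & \text{otherwise.}\end{cases}$$
   Context: The Fitzpatrick function of the operator $\log$ is $$F_{\log}(x,y)=\sup_{z>0}\big((z-x)(y-\log z)+xy\big),\qquad (x,y)\in\mathbb{R}^2.$$ The Fenchel conjugate is $F^\ast(x,y)=\sup_{(a,b)\in\mathbb{R}^2}\{ax+by-F(a,b)\}$. *)

theory Defs
  imports "HOL-Analysis.Analysis"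
begin

(* A set-valued operator is represented by its graph. Values are extended reals. *)
definition fitzpatrick :: "('a::real_inner \<times> 'a) set \<Rightarrow> 'a \<times> 'a \<Rightarrow> ereal" where
  "fitzpatrick G = (\<lambda>(x, y). SUP (z, w)\<in>G. ereal (inner (z - x) (y - w) + inner x y))"

(* Where f takes the value +infinity, "ereal r - f a" is -infinity, as usual. *)
definition fenchel_conjugate :: "('a::real_inner \<Rightarrow> ereal) \<Rightarrow> 'a \<Rightarrow> ereal" where
  "fenchel_conjugate f u = (SUP a. ereal (inner a u) - f a)"

(* The restriction to z > 0 matters: the library's ln is a total function. *)
definition gra_log :: "(real \<times> real) set" where
  "gra_log = {(z, ln z) | z. z > 0}"

definition F_log :: "real \<times> real \<Rightarrow> ereal" where
  "F_log = fitzpatrick gra_log"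

lemma F_log_eq:
  "F_log (x, y) = (SUP z\<in>{0<..}. ereal ((z - x) * (y - ln z) + x * y))"
proof -
  have *: "gra_log = (\<lambda>z. (z, ln z)) ` {0<..}"
    by (auto simp: gra_log_def)
  show ?thesis
    unfolding F_log_def fitzpatrick_def * by (simp add: image_image)
qed

lemma F_log_neq_MInf: "F_log p \<noteq> -\<infinity>"
proof (cases p)
  case (Pair x y)
  have "ereal ((1 - x) * (y - ln 1) + x * y) \<le> F_log (x, y)"
    unfolding F_log_eq by (rule SUP_upper) simp
  then show ?thesis
    using Pair by auto
qed

lemma fenchel_conjugate_real_pair:
  fixes f :: "real \<times> real \<Rightarrow> ereal"
  shows "fenchel_conjugate f (x, y) = (SUP (a, b). ereal (a * x + b * y) - f (a, b))"
  by (simp add: fenchel_conjugate_def inner_prod_def case_prod_beta)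

end

theory Submission
  imports Defs
begin

text \<open>
  Write \<open>F_log (a, b)\<close> as the supremum over \<open>z > 0\<close> of \<open>b z + a ln z - z ln z\<close>. This is
  \<open>\<infinity>\<close> for \<open>a < 0\<close> (let \<open>z \<rightarrow> 0\<close>). For \<open>a \<ge> 0\<close> the objective is concave in \<open>z\<close> and is
  maximal at \<open>z = t\<close> exactly if \<open>b = 1 + ln t - a / t\<close>. Testing the conjugate on the points
  \<open>(a, 1 + ln t - a / t)\<close> gives all lower bounds: \<open>a = 0, t = y\<close> in the finite case,
  \<open>t = y, a \<rightarrow> \<infinity>\<close> if \<open>0 < y < exp x\<close>, and \<open>a = 1, t \<rightarrow> 0\<close> if \<open>y \<le> 0\<close>. The upper bound
  comes from \<open>z = y\<close> in the supremum.
\<close>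

lemma F_log_ge:
  assumes "z > 0"
  shows "F_log (a, b) \<ge> ereal (b * z + a * ln z - z * ln z)"
proof -
  have "ereal ((z - a) * (b - ln z) + a * b) \<le> F_log (a, b)"
    unfolding F_log_eq using assms by (intro SUP_upper) simp
  then show ?thesis
    by (simp add: algebra_simps)
qed

lemma F_log_neg:
  assumes "a < 0"
  shows "F_log (a, b) = \<infinity>"
proof (rule ereal_top)
  fix r :: real
  \<comment> \<open>With \<open>z = exp (- s)\<close>, the term \<open>a * ln z\<close> equals
    \<open>(- a) * s\<close>. This \<open>s\<close> makes it at least \<open>r\<close> plus
    \<open>\<bar>b\<bar>\<close>, which absorbs \<open>b * z\<close> since
    \<open>z \<le> 1\<close>.\<close>
  define s where "s = max 0 ((r + \<bar>b\<bar>) / (- a))"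
  have s: "s \<ge> 0" "(- a) * s \<ge> r + \<bar>b\<bar>"
    using assms by (auto simp: s_def field_simps max_def)
  define z where "z = exp (- s)"
  have z: "0 < z" "z \<le> 1" "ln z = - s"
    using s by (auto simp: z_def)
  have "\<bar>b * z\<bar> \<le> \<bar>b\<bar>"
    using z by (simp add: abs_mult mult_left_le)
  moreover have "z * s \<ge> 0"
    using z s by simp
  ultimately have "r \<le> b * z + a * ln z - z * ln z"
    using s z(3) by (simp add: algebra_simps)
  also have "ereal \<dots> \<le> F_log (a, b)"
    by (rule F_log_ge) fact
  finally show "ereal r \<le> F_log (a, b)"
    by simp
qed

text \<open>The tangent bound \<open>ln u \<le> u - 1\<close> at \<open>u = z / t\<close> controls
  \<open>a * ln z\<close>, and at \<open>u = t / z\<close> it controls \<open>- z * ln z\<close>. In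
  the sum the terms in \<open>z\<close> cancel.\<close>

lemma F_log_stationary_le:
  assumes "t > 0" "a \<ge> 0"
  shows "F_log (a, 1 + ln t - a / t) \<le> ereal (a * ln t - a + t)"
  unfolding F_log_eq
proof (rule SUP_least)
  fix z :: real
  assume "z \<in> {0<..}"
  then have z: "z > 0" by simp
  have "ln (z / t) \<le> z / t - 1"
    using z assms by (intro ln_le_minus_one) simp
  then have "a * (ln z - ln t) \<le> a * (z / t - 1)"
    using z assms by (intro mult_left_mono) (auto simp: ln_div)
  moreover have "ln (t / z) \<le> t / z - 1"
    using z assms by (intro ln_le_minus_one) simp
  then have "z * (ln t - ln z) \<le> z * (t / z - 1)"
    using z assms by (intro mult_left_mono) (auto simp: ln_div)
  then have "z * (ln t - ln z) \<le> t - z"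
    using z by (simp add: algebra_simps)
  ultimately show "ereal ((z - a) * (1 + ln t - a / t - ln z) + a * (1 + ln t - a / t))
      \<le> ereal (a * ln t - a + t)"
    by (simp add: algebra_simps diff_divide_distrib)
qed

lemma fenchel_conjugate_F_log_ge:
  assumes "t > 0" "a \<ge> 0"
  shows "fenchel_conjugate F_log (x, y)
    \<ge> ereal (a * x + (1 + ln t - a / t) * y - (a * ln t - a + t))"
proof -
  let ?b = "1 + ln t - a / t"
  have "ereal (a * x + ?b * y - (a * ln t - a + t))
      = ereal (a * x + ?b * y) - ereal (a * ln t - a + t)"
    by simp
  also have "\<dots> \<le> ereal (a * x + ?b * y) - F_log (a, ?b)"
    using F_log_stationary_le[OF assms] by (rule ereal_minus_mono[OF order_refl])
  also have "\<dots> \<le> fenchel_conjugate F_log (x, y)"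
    unfolding fenchel_conjugate_real_pair by (rule SUP_upper2[of "(a, ?b)"]) auto
  finally show ?thesis .
qed

lemma fenchel_conjugate_F_log_le:
  assumes "y > 0" "x \<le> ln y"
  shows "fenchel_conjugate F_log (x, y) \<le> ereal (y * ln y)"
  unfolding fenchel_conjugate_real_pair
proof (rule SUP_least, clarify)
  fix a b :: real
  show "ereal (a * x + b * y) - F_log (a, b) \<le> ereal (y * ln y)"
  proof (cases "a < 0")
    case True
    \<comment> \<open>Here \<open>F_log (a, b)\<close> is \<open>\<infinity>\<close>, so the
      difference is \<open>-\<infinity>\<close>.\<close>
    then show ?thesis
      by (simp add: F_log_neg)
  next
    case False
    then have "a * x \<le> a * ln y"
      using assms by (intro mult_left_mono) auto
    have "ereal (a * x + b * y) - F_log (a, b)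
        \<le> ereal (a * x + b * y) - ereal (b * y + a * ln y - y * ln y)"
      using F_log_ge[OF assms(1)] by (rule ereal_minus_mono[OF order_refl])
    also have "\<dots> \<le> ereal (y * ln y)"
      using \<open>a * x \<le> a * ln y\<close> by simp
    finally show ?thesis .
  qed
qed

lemma fenchel_conjugate_F_log_eq_infinity_if_gt:
  assumes "y > 0" "x > ln y"
  shows "fenchel_conjugate F_log (x, y) = \<infinity>"
proof (rule ereal_top)
  fix r :: real
  \<comment> \<open>At \<open>t = y\<close> the lower bound is affine in \<open>a\<close> with slope
    \<open>x - ln y > 0\<close>, so a large \<open>a\<close> lifts it above
    \<open>r\<close>.\<close>
  define a where "a = max 0 ((r - y * ln y) / (x - ln y))"
  have a: "a \<ge> 0" "a * (x - ln y) \<ge> r - y * ln y"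
    using assms by (auto simp: a_def max_def field_simps)
  have "a * (x - ln y) + y * ln y = a * x + (1 + ln y - a / y) * y - (a * ln y - a + y)"
    using assms by (simp add: field_simps)
  then have "r \<le> a * x + (1 + ln y - a / y) * y - (a * ln y - a + y)"
    using a by linarith
  also have "ereal \<dots> \<le> fenchel_conjugate F_log (x, y)"
    using assms(1) a(1) by (rule fenchel_conjugate_F_log_ge)
  finally show "ereal r \<le> fenchel_conjugate F_log (x, y)"
    by simp
qed

lemma fenchel_conjugate_F_log_eq_infinity_if_nonpos:
  assumes "y \<le> 0"
  shows "fenchel_conjugate F_log (x, y) = \<infinity>"
proof (rule ereal_top)
  fix r :: real
  \<comment> \<open>For \<open>a = 1\<close> the lower bound is \<open>x - ln t\<close> plus
    \<open>1 - t\<close> plus a multiple of \<open>y\<close>. As \<open>t \<le> 1\<close>, both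
    additions are nonnegative, and \<open>- ln t \<ge> r - x\<close>.\<close>
  define t where "t = exp (- max 0 (r - x))"
  have t: "0 < t" "t \<le> 1" "ln t \<le> 0" "r \<le> x - ln t"
    by (auto simp: t_def)
  then have "1 / t \<ge> 1"
    by simp
  then have "1 + ln t - 1 / t \<le> 0"
    using t(3) by linarith
  then have "(1 + ln t - 1 / t) * y \<ge> 0"
    using assms by (intro mult_nonpos_nonpos)
  then have "r \<le> 1 * x + (1 + ln t - 1 / t) * y - (1 * ln t - 1 + t)"
    using t by linarith
  also have "ereal \<dots> \<le> fenchel_conjugate F_log (x, y)"
    using t(1) by (rule fenchel_conjugate_F_log_ge) simp
  finally show "ereal r \<le> fenchel_conjugate F_log (x, y)"
    by simp
qed

theorem corollary3p4:
  fixes x y :: real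
  shows "fenchel_conjugate F_log (x, y) =
    (if y > 0 \<and> x \<le> ln y then ereal (y * ln y) else \<infinity>)"
proof (cases "y > 0 \<and> x \<le> ln y")
  case True
  \<comment> \<open>At \<open>a = 0\<close>, \<open>t = y\<close> the bound reads
    \<open>(1 + ln y) * y - y\<close>.\<close>
  then have "ereal (y * ln y) \<le> fenchel_conjugate F_log (x, y)"
    using fenchel_conjugate_F_log_ge[of y 0 x y] by (simp add: algebra_simps)
  then show ?thesis
    using True fenchel_conjugate_F_log_le by (simp add: antisym)
next
  case False
  then show ?thesis
    using fenchel_conjugate_F_log_eq_infinity_if_gt[of y x]
      fenchel_conjugate_F_log_eq_infinity_if_nonpos[of y x]
    by (cases "y > 0") (auto simp: not_le not_less)
qed

end
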